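(* Let $A$ be a unital separable C*-algebra, $H$ a separable Hilbert space, $G$ a group, and $\tau : G \to \mathrm{Aut}(A)$ an action of $G$ on $A$ by *-automorphisms. Let $\phi \in \mathrm{UCP}^G_A(H)$, let $V^*\rho V$ be the minimal Stinespring dilation of $\phi$ on the Hilbert space $K$, and let $U_\phi$ be the associated unitary representation of $G$ on $K$. Then the map $T \mapsto \phi_T$, where $\phi_T(a) = V^*\rho(a)TV$ for $a\in A$, is an affine isomorphism of the partially ordered convex set of operators $\{T \in (\rho(A)\cup U_\phi(G))' : 0\le T\le 1_K\}$ onto $[0,\phi]\cap \mathrm{CP}^G_A(H)$.
   Context: $\mathrm{UCP}^G_A(H)$ is the set of unital completely positive maps $\phi:A\to B(H)$ with $\phi(\tau_g(a))=\phi(a)$ for all $g\in G$, $a\in A$. $\mathrm{CP}^G_A(H)$ is the set of all completely positive maps $\theta:A\to B(H)$ with $\theta(\tau_g(a))=\theta(a)$ for all $g\in G$, $a\in A$. $[0,\phi]$ is the set of completely positive $\theta:A\to B(H)$ such that $\phi-\theta$ is completely positive; the partial order on completely positive maps is $\theta_1\le\theta_2$ iff $\theta_2-\theta_1$ is completely positive. Minimal Stinespring dilation: a Hilbert space $K$, an isometry $V: H\to K$ and a unital *-representation $\rho: A\to B(K)$ with $\phi(a)=V^*\rho(a)V$ and $\overline{\mathrm{span}}\,\rho(A)VH = K$. Since $\phi$ is $G$-invariant, there is a unitary representation $U_\phi: G\to B(K)$ determined by $U_\phi(g)V = V$ and $U_\phi(g)\rho(a)U_\phi(g)^* = \rho(\tau_g(a))$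 for all $a\in A$, $g\in G$. Primes denote commutants in $B(K)$. *)

theory Defs
  imports "HOL-Analysis.Analysis" "HOL-Algebra.Group" "HOL-Library.Function_Algebras"
begin

section \<open>Complex vector spaces\<close>

class scaleC =
  fixes scaleC :: "complex \<Rightarrow> 'a \<Rightarrow> 'a" (infixr "*\<^sub>C" 75)

class complex_vector = real_vector + scaleC +
  assumes scaleC_add_right: "c *\<^sub>C (x + y) = c *\<^sub>C x + c *\<^sub>C y"
    and scaleC_add_left: "(c + d) *\<^sub>C x = c *\<^sub>C x + d *\<^sub>C x"
    and scaleC_scaleC: "c *\<^sub>C d *\<^sub>C x = (c * d) *\<^sub>C x"
    and scaleC_one: "1 *\<^sub>C x = x"
    and scaleR_scaleC: "r *\<^sub>R x = complex_of_real r *\<^sub>C x"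

global_interpretation cvs: vector_space "scaleC :: complex \<Rightarrow> 'a \<Rightarrow> 'a::complex_vector"
  by unfold_locales (simp_all add: scaleC_add_right scaleC_add_left scaleC_scaleC scaleC_one)

abbreviation clinear :: "('a::complex_vector \<Rightarrow> 'b::complex_vector) \<Rightarrow> bool" where
  "clinear \<equiv> Vector_Spaces.linear scaleC scaleC"

class complex_normed_vector = real_normed_vector + complex_vector +
  assumes norm_scaleC: "norm (c *\<^sub>C x) = cmod c * norm x"

instantiation "fun" :: (type, real_vector) real_vector
begin

definition scaleR_fun :: "real \<Rightarrow> ('a \<Rightarrow> 'b) \<Rightarrow> 'a \<Rightarrow> 'b" where
  "r *\<^sub>R f = (\<lambda>x. r *\<^sub>R f x)"

instance
  by standard (simp_all add: scaleR_fun_def fun_eq_iff scaleR_add_right scaleR_add_left)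

end

section \<open>C*-algebras\<close>

text \<open>
  The unital algebra structure is taken from \<^class>\<open>monoid_mult\<close> rather than from
  \<^class>\<open>ring_1\<close>, so that the zero algebra is not excluded.
\<close>

class unital_cstar_algebra = banach + real_normed_algebra + monoid_mult + complex_normed_vector +
  fixes star :: "'a \<Rightarrow> 'a"
  assumes mult_scaleC_left: "(c *\<^sub>C a) * b = c *\<^sub>C (a * b)"
    and mult_scaleC_right: "a * (c *\<^sub>C b) = c *\<^sub>C (a * b)"
    and star_star: "star (star a) = a"
    and star_add: "star (a + b) = star a + star b"
    and star_scaleC: "star (c *\<^sub>C a) = cnj c *\<^sub>C star a"
    and star_mult: "star (a * b) = star b * star a"
    and cstar_identity: "norm (star a * a) = (norm a)\<^sup>2"

definition star_automorphism :: "('a::unital_cstar_algebra \<Rightarrow> 'a) \<Rightarrow> bool" where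
  "star_automorphism \<alpha> \<longleftrightarrow> bij \<alpha> \<and> clinear \<alpha> \<and>
     (\<forall>a b. \<alpha> (a * b) = \<alpha> a * \<alpha> b) \<and> (\<forall>a. \<alpha> (star a) = star (\<alpha> a))"

definition Aut :: "('a::unital_cstar_algebra \<Rightarrow> 'a) monoid" where
  "Aut = \<lparr>carrier = {\<alpha>. star_automorphism \<alpha>}, mult = (\<circ>), one = id\<rparr>"

section \<open>Hilbert spaces and their operators\<close>

text \<open>The inner product is conjugate-linear in the first argument.\<close>

class complex_hilbert_space = banach + complex_normed_vector +
  fixes cinner :: "'a \<Rightarrow> 'a \<Rightarrow> complex"
  assumes cinner_commute: "cinner x y = cnj (cinner y x)"
    and cinner_add_right: "cinner x (y + z) = cinner x y + cinner x z"
    and cinner_scaleC_right: "cinner x (c *\<^sub>C y) = c * cinner x y"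
    and cinner_self: "cinner x x = complex_of_real ((norm x)\<^sup>2)"

instantiation blinfun :: (real_normed_vector, complex_normed_vector) complex_vector
begin

lift_definition scaleC_blinfun :: "complex \<Rightarrow> 'a \<Rightarrow>\<^sub>L 'b \<Rightarrow> 'a \<Rightarrow>\<^sub>L 'b" is
  "\<lambda>c f x. c *\<^sub>C f x"
proof -
  fix c and f :: "'a \<Rightarrow> 'b"
  assume "bounded_linear f"
  then interpret bounded_linear f .
  obtain K where K: "\<And>x. norm (f x) \<le> norm x * K"
    using bounded by blast
  have "norm (c *\<^sub>C f x) \<le> norm x * (cmod c * K)" for x
    using mult_left_mono[OF K[of x], of "cmod c"] by (simp add: norm_scaleC algebra_simps)
  then show "bounded_linear (\<lambda>x. c *\<^sub>C f x)"
    by (intro bounded_linear_intro[where K = "cmod c * K"])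
       (simp_all add: add scaleR scaleR_scaleC scaleC_add_right scaleC_scaleC mult.commute)
qed

instance
  by standard
    (transfer; simp add: fun_eq_iff scaleC_add_right scaleC_add_left scaleC_scaleC scaleC_one
      scaleR_scaleC)+

end

text \<open>
  The library's type of bounded linear maps consists of the real-linear ones; the bounded
  operators between Hilbert spaces are the complex-linear maps among them.
\<close>

definition bounded_ops :: "('h::complex_hilbert_space \<Rightarrow>\<^sub>L 'k::complex_hilbert_space) set" where
  "bounded_ops = {T. clinear (blinfun_apply T)}"

text \<open>
  By the Riesz representation theorem \<open>adj T\<close> is well-defined whenever \<open>T\<close> is complex-linear;
  its value is unspecified otherwise.
\<close>

definition adj :: "'h::complex_hilbert_space \<Rightarrow>\<^sub>L 'k::complex_hilbert_space \<Rightarrow> 'k \<Rightarrow>\<^sub>L 'h" where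
  "adj T = (THE S. \<forall>x y. cinner (blinfun_apply S y) x = cinner y (T x))"

definition isometry :: "'h::complex_hilbert_space \<Rightarrow>\<^sub>L 'k::complex_hilbert_space \<Rightarrow> bool" where
  "isometry V \<longleftrightarrow> V \<in> bounded_ops \<and> (\<forall>x. norm (V x) = norm x)"

definition unitary :: "'k::complex_hilbert_space \<Rightarrow>\<^sub>L 'k \<Rightarrow> bool" where
  "unitary U \<longleftrightarrow> U \<in> bounded_ops \<and> adj U o\<^sub>L U = id_blinfun \<and> U o\<^sub>L adj U = id_blinfun"

definition unitary_group :: "('k::complex_hilbert_space \<Rightarrow>\<^sub>L 'k) monoid" where
  "unitary_group = \<lparr>carrier = {U. unitary U}, mult = (o\<^sub>L), one = id_blinfun\<rparr>"

definition positive_op :: "'k::complex_hilbert_space \<Rightarrow>\<^sub>L 'k \<Rightarrow> bool" where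
  "positive_op T \<longleftrightarrow> T \<in> bounded_ops \<and> (\<forall>x. cinner x (T x) \<in> \<real>\<^sub>\<ge>\<^sub>0)"

definition op_le :: "'k::complex_hilbert_space \<Rightarrow>\<^sub>L 'k \<Rightarrow> 'k \<Rightarrow>\<^sub>L 'k \<Rightarrow> bool" where
  "op_le S T \<longleftrightarrow> positive_op (T - S)"

definition commutant :: "('k::complex_hilbert_space \<Rightarrow>\<^sub>L 'k) set \<Rightarrow> ('k \<Rightarrow>\<^sub>L 'k) set" where
  "commutant M = {T \<in> bounded_ops. \<forall>S\<in>M. T o\<^sub>L S = S o\<^sub>L T}"

section \<open>Completely positive maps\<close>

text \<open>
  An \<open>n \<times> n\<close> matrix is a function of two natural-number arguments of which only the values at
  indices below \<open>n\<close> matter. An element of the C*-algebra of \<open>n \<times> n\<close> matrices over \<open>A\<close> is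
  positive if it has the form \<open>x\<^sup>* x\<close>. A matrix of operators on \<open>H\<close> is positive if it is a
  positive operator on the direct sum of \<open>n\<close> copies of \<open>H\<close>.
\<close>

definition positive_matrix :: "nat \<Rightarrow> (nat \<Rightarrow> nat \<Rightarrow> 'a::unital_cstar_algebra) \<Rightarrow> bool" where
  "positive_matrix n a \<longleftrightarrow>
     (\<exists>x. \<forall>i<n. \<forall>j<n. a i j = (\<Sum>k<n. star (x k i) * x k j))"

definition positive_op_matrix ::
    "nat \<Rightarrow> (nat \<Rightarrow> nat \<Rightarrow> 'h::complex_hilbert_space \<Rightarrow>\<^sub>L 'h) \<Rightarrow> bool" where
  "positive_op_matrix n T \<longleftrightarrow> (\<forall>i<n. \<forall>j<n. T i j \<in> bounded_ops) \<and>
     (\<forall>h. (\<Sum>i<n. cinner (h i) (\<Sum>j<n. T i j (h j))) \<in> \<real>\<^sub>\<ge>\<^sub>0)"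

definition completely_positive ::
    "('a::unital_cstar_algebra \<Rightarrow> 'h::complex_hilbert_space \<Rightarrow>\<^sub>L 'h) \<Rightarrow> bool" where
  "completely_positive \<theta> \<longleftrightarrow> range \<theta> \<subseteq> bounded_ops \<and> clinear \<theta> \<and>
     (\<forall>n a. positive_matrix n a \<longrightarrow> positive_op_matrix n (\<lambda>i j. \<theta> (a i j)))"

definition cp_le ::
    "('a::unital_cstar_algebra \<Rightarrow> 'h::complex_hilbert_space \<Rightarrow>\<^sub>L 'h) \<Rightarrow> ('a \<Rightarrow> 'h \<Rightarrow>\<^sub>L 'h) \<Rightarrow> bool" where
  "cp_le \<theta>\<^sub>1 \<theta>\<^sub>2 \<longleftrightarrow> completely_positive (\<theta>\<^sub>2 - \<theta>\<^sub>1)"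

definition cp_interval ::
    "('a::unital_cstar_algebra \<Rightarrow> 'h::complex_hilbert_space \<Rightarrow>\<^sub>L 'h) \<Rightarrow> ('a \<Rightarrow> 'h \<Rightarrow>\<^sub>L 'h) set" where
  "cp_interval \<phi> = {\<theta>. completely_positive \<theta> \<and> completely_positive (\<phi> - \<theta>)}"

definition invariant_CP ::
    "('g, 'm) monoid_scheme \<Rightarrow> ('g \<Rightarrow> 'a \<Rightarrow> 'a) \<Rightarrow>
     ('a::unital_cstar_algebra \<Rightarrow> 'h::complex_hilbert_space \<Rightarrow>\<^sub>L 'h) set" where
  "invariant_CP G \<tau> =
     {\<theta>. completely_positive \<theta> \<and> (\<forall>g\<in>carrier G. \<forall>a. \<theta> (\<tau> g a) = \<theta> a)}"

definition invariant_UCP ::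
    "('g, 'm) monoid_scheme \<Rightarrow> ('g \<Rightarrow> 'a \<Rightarrow> 'a) \<Rightarrow>
     ('a::unital_cstar_algebra \<Rightarrow> 'h::complex_hilbert_space \<Rightarrow>\<^sub>L 'h) set" where
  "invariant_UCP G \<tau> = {\<phi> \<in> invariant_CP G \<tau>. \<phi> 1 = id_blinfun}"

section \<open>Stinespring dilations\<close>

definition unital_star_rep ::
    "('a::unital_cstar_algebra \<Rightarrow> 'k::complex_hilbert_space \<Rightarrow>\<^sub>L 'k) \<Rightarrow> bool" where
  "unital_star_rep \<rho> \<longleftrightarrow> range \<rho> \<subseteq> bounded_ops \<and> clinear \<rho> \<and>
     (\<forall>a b. \<rho> (a * b) = \<rho> a o\<^sub>L \<rho> b) \<and> (\<forall>a. \<rho> (star a) = adj (\<rho> a)) \<and> \<rho> 1 = id_blinfun"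

definition minimal_stinespring ::
    "('a::unital_cstar_algebra \<Rightarrow> 'h::complex_hilbert_space \<Rightarrow>\<^sub>L 'h) \<Rightarrow>
     ('h \<Rightarrow>\<^sub>L 'k::complex_hilbert_space) \<Rightarrow> ('a \<Rightarrow> 'k \<Rightarrow>\<^sub>L 'k) \<Rightarrow> bool" where
  "minimal_stinespring \<phi> V \<rho> \<longleftrightarrow> isometry V \<and> unital_star_rep \<rho> \<and>
     (\<forall>a. \<phi> a = adj V o\<^sub>L \<rho> a o\<^sub>L V) \<and>
     closure (cvs.span {\<rho> a (V h) | a h. True}) = UNIV"

definition associated_unitary_rep ::
    "('g, 'm) monoid_scheme \<Rightarrow> ('g \<Rightarrow> 'a \<Rightarrow> 'a) \<Rightarrow>
     ('h::complex_hilbert_space \<Rightarrow>\<^sub>L 'k::complex_hilbert_space) \<Rightarrow>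
     ('a::unital_cstar_algebra \<Rightarrow> 'k \<Rightarrow>\<^sub>L 'k) \<Rightarrow> ('g \<Rightarrow> 'k \<Rightarrow>\<^sub>L 'k) \<Rightarrow> bool" where
  "associated_unitary_rep G \<tau> V \<rho> U \<longleftrightarrow> U \<in> hom G unitary_group \<and>
     (\<forall>g\<in>carrier G. U g o\<^sub>L V = V \<and> (\<forall>a. U g o\<^sub>L \<rho> a o\<^sub>L adj (U g) = \<rho> (\<tau> g a)))"

section \<open>Partially ordered convex sets\<close>

definition ordered_convex_set :: "'v::real_vector set \<Rightarrow> ('v \<Rightarrow> 'v \<Rightarrow> bool) \<Rightarrow> bool" where
  "ordered_convex_set C leq \<longleftrightarrow>
     convex C \<and> partial_order_on C {(x, y). x \<in> C \<and> y \<in> C \<and> leq x y}"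

definition affine_order_iso ::
    "'v::real_vector set \<Rightarrow> ('v \<Rightarrow> 'v \<Rightarrow> bool) \<Rightarrow>
     'w::real_vector set \<Rightarrow> ('w \<Rightarrow> 'w \<Rightarrow> bool) \<Rightarrow> ('v \<Rightarrow> 'w) \<Rightarrow> bool" where
  "affine_order_iso C leq\<^sub>C D leq\<^sub>D F \<longleftrightarrow>
     ordered_convex_set C leq\<^sub>C \<and> ordered_convex_set D leq\<^sub>D \<and> bij_betw F C D \<and>
     (\<forall>x\<in>C. \<forall>y\<in>C. \<forall>t\<in>{0..1}. F ((1 - t) *\<^sub>R x + t *\<^sub>R y) = (1 - t) *\<^sub>R F x + t *\<^sub>R F y) \<and>
     (\<forall>x\<in>C. \<forall>y\<in>C. leq\<^sub>C x y \<longleftrightarrow> leq\<^sub>D (F x) (F y))"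

end

theory Submission
  imports Defs
begin

text \<open>
  Write \<open>\<theta>\<close> as the sesquilinear form \<open>(a \<otimes> h, b \<otimes> k) \<mapsto> \<langle>h, \<theta>(a\<^sup>* b) k\<rangle>\<close> on \<open>A \<otimes> H\<close>.
  For \<open>0 \<le> \<theta> \<le> \<phi>\<close> it is positive and dominated by the form of \<open>\<phi>\<close>, which is the inner product
  of \<open>K\<close> pulled back along \<open>a \<otimes> h \<mapsto> \<rho>(a) V h\<close>. By the Cauchy-Schwarz inequality and the Riesz
  theorem it is therefore given by an operator \<open>T\<close> on \<open>K\<close>; the identity
  \<open>\<langle>h, \<theta>(a\<^sup>* (c b)) k\<rangle> = \<langle>h, \<theta>((c\<^sup>* a)\<^sup>* b) k\<rangle>\<close> says that \<open>T\<close> commutes with \<open>\<rho>(c)\<close>, and invariance of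
  \<open>\<theta>\<close> under \<open>\<tau>\<close> says that \<open>T\<close> commutes with \<open>U\<close>. Since the elements \<open>\<rho>(a) V h\<close> span a dense
  subspace, \<open>\<phi>\<^sub>R\<close> is completely positive exactly when \<open>R \<ge> 0\<close>, for every \<open>R\<close> in the commutant of
  \<open>\<rho>(A)\<close>; applied to differences this shows that \<open>T \<mapsto> \<phi>\<^sub>T\<close> is an order embedding, hence injective.
\<close>

section \<open>The Cauchy-Schwarz inequality from positivity alone\<close>

text \<open>Think of \<open>p\<close>, \<open>z\<close>, \<open>w\<close>, \<open>q\<close> as the
  values of a sesquilinear form at (x,x), (x,y), (y,x), (y,y); \<open>nn\<close> is then its
  positivity at x + c y. Serves both \<open>cinner\<close> and \<open>kernel\<close>. Reality of the
  values at c = 1 and c = \<i> yields the Hermitian symmetry \<open>w = cnj z\<close>.\<close>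

lemma cauchy_schwarz_coefficients:
  fixes p q z w :: complex
  assumes nn: "\<And>c. p + c * z + cnj c * w + c * cnj c * q \<in> \<real>\<^sub>\<ge>\<^sub>0"
    and p: "p \<in> \<real>\<^sub>\<ge>\<^sub>0" and q: "q \<in> \<real>\<^sub>\<ge>\<^sub>0"
  shows "(cmod z)\<^sup>2 \<le> Re p * Re q"
proof -
  have pq: "Re p \<ge> 0" "Im p = 0" "Re q \<ge> 0" "Im q = 0"
    using p q by (auto simp: complex_nonneg_Reals_iff)
  have "Im z + Im w = 0"
    using nn[of 1] pq by (auto simp: complex_nonneg_Reals_iff)
  moreover have "Re z - Re w = 0"
    using nn[of \<i>] pq by (auto simp: complex_nonneg_Reals_iff)
  ultimately have w: "w = cnj z"
    by (simp add: complex_eq_iff)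
  \<comment> \<open>The choice \<open>c = - s * cnj z\<close> aligns the phases. If
    \<open>Re q > 0\<close>, the minimiser \<open>s = 1 / Re q\<close> gives the claim; if
    \<open>Re q = 0\<close>, the expression is affine in \<open>s\<close> and becomes negative for
    large \<open>s\<close> unless \<open>z = 0\<close>.\<close>
  have quad: "Re p - 2 * s * (cmod z)\<^sup>2 + s\<^sup>2 * (cmod z)\<^sup>2 * Re q \<ge> 0" for s
    using nn[of "- of_real s * cnj z"] pq unfolding complex_nonneg_Reals_iff w
    by (simp add: cmod_power2 algebra_simps) (simp add: algebra_simps power2_eq_square)
  show "(cmod z)\<^sup>2 \<le> Re p * Re q"
  proof (cases "Re q = 0")
    case True
    have "cmod z = 0"
    proof (rule ccontr)
      assume "cmod z \<noteq> 0"
      then have "(Re p + 1) / (cmod z)\<^sup>2 * (cmod z)\<^sup>2 = Re p + 1" by simp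
      then show False
        using quad[of "(Re p + 1) / (cmod z)\<^sup>2"] True pq by (simp add: mult.assoc split: if_splits)
    qed
    then show ?thesis using True by simp
  next
    case False
    then show ?thesis
      using quad[of "1 / Re q"] pq by (simp add: field_simps power2_eq_square)
  qed
qed

section \<open>Inner products\<close>

lemma cinner_add_left: "cinner (x + y) z = cinner x z + cinner y z"
  by (metis cinner_commute cinner_add_right complex_cnj_add)

lemma cinner_scaleC_left: "cinner (c *\<^sub>C x) y = cnj c * cinner x y"
  by (metis cinner_commute cinner_scaleC_right complex_cnj_mult)

lemma cinner_self_nonneg: "cinner x x \<in> \<real>\<^sub>\<ge>\<^sub>0"
  by (simp add: cinner_self)

lemma cmod_cinner_le: "cmod (cinner x y) \<le> norm x * norm y"
proof -
  have "cinner x x + c * cinner x y + cnj c * cinner y x + c * cnj c * cinner y y \<in> \<real>\<^sub>\<ge>\<^sub>0" for c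
    using cinner_self_nonneg[of "x + c *\<^sub>C y"]
    by (simp add: cinner_add_left cinner_add_right cinner_scaleC_left cinner_scaleC_right algebra_simps)
  from cauchy_schwarz_coefficients[OF this cinner_self_nonneg cinner_self_nonneg]
  have "(cmod (cinner x y))\<^sup>2 \<le> (norm x * norm y)\<^sup>2"
    by (simp add: cinner_self power_mult_distrib)
  then show ?thesis
    by (rule power2_le_imp_le) simp
qed

interpretation cinner: bounded_bilinear cinner
proof
  show "\<exists>K. \<forall>a b. norm (cinner a b) \<le> norm a * norm b * K"
    by (intro exI[of _ 1]) (simp add: cmod_cinner_le)
qed (simp_all add: cinner_add_left cinner_add_right cinner_scaleC_left cinner_scaleC_right
    scaleR_scaleC scaleR_conv_of_real)

lemma clinear_iff:
  "clinear f \<longleftrightarrow> (\<forall>x y. f (x + y) = f x + f y) \<and> (\<forall>c x. f (c *\<^sub>C x) = c *\<^sub>C f x)"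
  by (auto simp: Vector_Spaces.linear_def module_hom_def module_hom_axioms_def
      cvs.vector_space_axioms cvs.module_axioms)

text \<open>By continuity the bound passes from \<open>D\<close> to all vectors and may be tested at
  \<open>d = w\<close>. The case \<open>C = 0\<close> gives uniqueness of vectors tested on a dense
  set.\<close>

lemma cinner_le_imp_norm_le:
  assumes D: "closure D = UNIV" and le: "\<And>d. d \<in> D \<Longrightarrow> cmod (cinner w d) \<le> C * norm d" and "C \<ge> 0"
  shows "norm w \<le> C"
proof -
  have "closed {d. cmod (cinner w d) \<le> C * norm d}"
    by (intro closed_Collect_le continuous_intros cinner.continuous_on)
  then have "closure D \<subseteq> {d. cmod (cinner w d) \<le> C * norm d}"
    using le by (intro closure_minimal) auto
  with D have "cmod (cinner w w) \<le> C * norm w" by auto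
  then have "norm w * norm w \<le> C * norm w"
    by (simp add: cinner_self norm_mult power2_eq_square)
  then show ?thesis using \<open>C \<ge> 0\<close>
    by (cases "w = 0") auto
qed

lemma cinner_dense_eqI:
  assumes D: "closure D = UNIV" and eq: "\<And>d. d \<in> D \<Longrightarrow> cinner w d = cinner w' d"
  shows "w = w'"
proof -
  have "norm (w - w') \<le> 0"
    by (rule cinner_le_imp_norm_le[OF D]) (simp_all add: cinner.diff_left eq)
  then show ?thesis by simp
qed

lemma cinner_eqI: "(\<And>d. cinner d w = cinner d w') \<Longrightarrow> w = w'"
  by (rule cinner_dense_eqI[of UNIV]) (simp, metis cinner_commute)

lemma norm_add_sq: "(norm (x + y))\<^sup>2 = (norm x)\<^sup>2 + 2 * Re (cinner x y) + (norm y)\<^sup>2"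
proof -
  have "Re (cinner (x + y) (x + y)) = Re (cinner x x) + 2 * Re (cinner x y) + Re (cinner y y)"
    using cinner_commute[of y x] by (simp add: cinner_add_left cinner_add_right)
  then show ?thesis by (simp add: cinner_self)
qed

section \<open>Riesz representation and adjoints\<close>

text \<open>
  The functional is given by its graph, so that it may be prescribed on vectors without
  first checking that its values are independent of their representation.
  The representing vector is the limit of a sequence minimising \<open>\<parallel>v\<parallel>\<^sup>2 - 2 Re c\<close> over the graph,
  which is Cauchy by the parallelogram law.
\<close>

lemma riesz_representation_graph:
  fixes \<Gamma> :: "('k::complex_hilbert_space \<times> complex) set"
  assumes ne: "\<Gamma> \<noteq> {}"
    and add: "\<And>v c v' c'. (v, c) \<in> \<Gamma> \<Longrightarrow> (v', c') \<in> \<Gamma> \<Longrightarrow> (v + v', c + c') \<in> \<Gamma>"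
    and scale: "\<And>v c s. (v, c) \<in> \<Gamma> \<Longrightarrow> (s *\<^sub>C v, s * c) \<in> \<Gamma>"
    and bound: "\<And>v c. (v, c) \<in> \<Gamma> \<Longrightarrow> cmod c \<le> C * norm v"
  shows "\<exists>t. \<forall>(v, c)\<in>\<Gamma>. cinner t v = c"
proof -
  define q where "q = (\<lambda>(v::'k, c). (norm v)\<^sup>2 - 2 * Re c)"
  have low: "- C\<^sup>2 \<le> q p" if "p \<in> \<Gamma>" for p
  proof -
    obtain v c where p: "p = (v, c)" by (cases p)
    have "Re c \<le> C * norm v"
      using bound[of v c] that p complex_Re_le_cmod[of c] by simp
    moreover have "0 \<le> (norm v - C)\<^sup>2" by simp
    ultimately show ?thesis
      by (simp add: p q_def power2_diff algebra_simps)
  qed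
  define m where "m = Inf (q ` \<Gamma>)"
  have bdd: "bdd_below (q ` \<Gamma>)"
    using low by (rule bdd_belowI2)
  have m_le: "m \<le> q p" if "p \<in> \<Gamma>" for p
    unfolding m_def using that bdd by (auto intro: cINF_lower)
  have "\<exists>p\<in>\<Gamma>. q p < m + inverse (Suc n)" for n
    using cInf_lessD[of "q ` \<Gamma>" "m + inverse (Suc n)"] ne by (auto simp: m_def)
  then obtain p where p: "\<And>n. p n \<in> \<Gamma>" "\<And>n. q (p n) < m + inverse (Suc n)"
    by metis
  have par: "(norm (fst x - fst y))\<^sup>2 \<le> 2 * (q x - m) + 2 * (q y - m)"
    if "x \<in> \<Gamma>" "y \<in> \<Gamma>" for x y
  proof -
    obtain v c v' c' where xy: "x = (v, c)" "y = (v', c')" by (cases x, cases y)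
    \<comment> \<open>The midpoint stays in the graph, so its value is at least \<open>m\<close>;
      the parallelogram law turns this into a bound on the distance.\<close>
    have "((1/2) *\<^sub>C (v + v'), (1/2) * (c + c')) \<in> \<Gamma>"
      using that scale[OF add, of v c v' c' "1/2"] xy by simp
    then have "m \<le> (norm ((1/2) *\<^sub>C (v + v')))\<^sup>2 - Re (c + c')"
      using m_le[of "((1/2) *\<^sub>C (v + v'), (1/2) * (c + c'))"] by (simp add: q_def field_simps)
    then have "4 * m \<le> (norm (v + v'))\<^sup>2 - 4 * Re (c + c')"
      by (simp add: norm_scaleC power_divide power_mult_distrib norm_divide)
    then show ?thesis
      using norm_add_sq[of v v'] norm_add_sq[of v "- v'"]
      by (simp add: xy q_def cinner.minus_right)
  qed
  have lim_q: "(\<lambda>n. q (p n)) \<longlonglongrightarrow> m"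
  proof (rule tendsto_sandwich)
    show "(\<lambda>n. m) \<longlonglongrightarrow> m" by simp
    show "(\<lambda>n. m + inverse (real (Suc n))) \<longlonglongrightarrow> m"
      using tendsto_add[OF tendsto_const LIMSEQ_inverse_real_of_nat, of m] by simp
  qed (use m_le p in \<open>auto intro!: always_eventually less_imp_le\<close>)
  have "Cauchy (\<lambda>n. fst (p n))"
  proof (rule metric_CauchyI)
    fix e :: real assume "e > 0"
    then have "e\<^sup>2 / 4 > 0" by simp
    from LIMSEQ_D[OF lim_q this] obtain N where N: "\<And>n. n \<ge> N \<Longrightarrow> \<bar>q (p n) - m\<bar> < e\<^sup>2 / 4"
      by auto
    have "dist (fst (p i)) (fst (p j)) < e" if "i \<ge> N" "j \<ge> N" for i j
    proof -
      have "(norm (fst (p i) - fst (p j)))\<^sup>2 < e\<^sup>2"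
        using par[OF p(1) p(1), of i j] N[OF that(1), THEN abs_less_iff[THEN iffD1]]
          N[OF that(2), THEN abs_less_iff[THEN iffD1]]
        by (simp add: field_simps)
      then show ?thesis
        using \<open>e > 0\<close> by (simp add: dist_norm power_less_imp_less_base)
    qed
    then show "\<exists>M. \<forall>i\<ge>M. \<forall>j\<ge>M. dist (fst (p i)) (fst (p j)) < e" by blast
  qed
  then obtain t where t: "(\<lambda>n. fst (p n)) \<longlonglongrightarrow> t"
    using Cauchy_convergent convergent_def by blast
  have re: "Re (cinner t v) = Re c" if vc: "(v, c) \<in> \<Gamma>" for v c
  proof -
    define d where "d = Re (cinner t v) - Re c"
    \<comment> \<open>First-order condition at the minimiser. As \<open>t\<close> may lie outside
      the domain of the graph, the perturbation by \<open>s\<close> times \<open>(v, c)\<close> is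
      made at each \<open>p n\<close>, followed by the limit.\<close>
    have quad: "0 \<le> 2 * s * d + s\<^sup>2 * (norm v)\<^sup>2" for s :: real
    proof -
      have "m \<le> q (p n) + 2 * s * (Re (cinner (fst (p n)) v) - Re c) + s\<^sup>2 * (norm v)\<^sup>2" for n
      proof -
        obtain u b where u: "p n = (u, b)" by (cases "p n")
        have "(u + of_real s *\<^sub>C v, b + of_real s * c) \<in> \<Gamma>"
          using p(1)[of n] u vc add scale by simp
        from m_le[OF this] show ?thesis
          by (simp add: u q_def norm_add_sq cinner_scaleC_right norm_scaleC algebra_simps)
      qed
      moreover have "(\<lambda>n. q (p n) + 2 * s * (Re (cinner (fst (p n)) v) - Re c) + s\<^sup>2 * (norm v)\<^sup>2)
          \<longlonglongrightarrow> m + 2 * s * d + s\<^sup>2 * (norm v)\<^sup>2"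
        unfolding d_def by (intro tendsto_intros lim_q cinner.tendsto t)
      ultimately have "m \<le> m + 2 * s * d + s\<^sup>2 * (norm v)\<^sup>2"
        by (intro LIMSEQ_le_const) auto
      then show ?thesis by simp
    qed
    \<comment> \<open>Adding 1 keeps the denominator positive even for \<open>v = 0\<close>; then
      \<open>s = - d / N\<close> gives \<open>0 \<le> - d\<^sup>2 / N\<close>.\<close>
    define N where "N = (norm v)\<^sup>2 + 1"
    have "N > 0" by (simp add: N_def add_nonneg_pos)
    have "0 \<le> 2 * (- d / N) * d + (- d / N)\<^sup>2 * N"
      by (rule order_trans[OF quad add_left_mono]) (simp add: N_def mult_left_mono)
    then have "d\<^sup>2 \<le> 0"
      using \<open>N > 0\<close> by (simp add: field_simps power2_eq_square)
    then have "d = 0"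
      by simp
    then show ?thesis by (simp add: d_def)
  qed
  \<comment> \<open>Applying \<open>re\<close> to \<i> times the pair supplies the imaginary
    parts.\<close>
  have "cinner t v = c" if vc: "(v, c) \<in> \<Gamma>" for v c
    using re[OF vc] re[OF scale[OF vc, of \<i>]]
    by (simp add: complex_eq_iff cinner_scaleC_right)
  then show ?thesis by auto
qed

text \<open>The adjoint of a bounded, densely defined operator given by its graph: Riesz yields
  \<open>S z\<close> from the functional sending v to <z, w>, and density makes \<open>S\<close>
  linear and bounded. It is applied to everywhere defined operators to obtain \<open>adj\<close>,
  and to the form of a dominated map in \<open>kernel_operator\<close>.\<close>

lemma adjoint_graph:
  fixes \<Gamma> :: "('k::complex_hilbert_space \<times> 'l::complex_hilbert_space) set"
  assumes dense: "closure (fst ` \<Gamma>) = UNIV"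
    and add: "\<And>v w v' w'. (v, w) \<in> \<Gamma> \<Longrightarrow> (v', w') \<in> \<Gamma> \<Longrightarrow> (v + v', w + w') \<in> \<Gamma>"
    and scale: "\<And>v w s. (v, w) \<in> \<Gamma> \<Longrightarrow> (s *\<^sub>C v, s *\<^sub>C w) \<in> \<Gamma>"
    and bound: "\<And>v w. (v, w) \<in> \<Gamma> \<Longrightarrow> norm w \<le> C * norm v" and "C \<ge> 0"
  obtains S :: "'l \<Rightarrow>\<^sub>L 'k" where "S \<in> bounded_ops"
    "\<And>z v w. (v, w) \<in> \<Gamma> \<Longrightarrow> cinner (S z) v = cinner z w"
proof -
  have bd: "cmod (cinner z w) \<le> (C * norm z) * norm v" if "(v, w) \<in> \<Gamma>" for z v w
  proof -
    have "cmod (cinner z w) \<le> norm z * norm w" by (rule cmod_cinner_le)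
    also have "\<dots> \<le> norm z * (C * norm v)"
      by (intro mult_left_mono bound that norm_ge_zero)
    finally show ?thesis by (simp add: mult_ac)
  qed
  have "\<exists>t. \<forall>(v, c)\<in>(\<lambda>(v, w). (v, cinner z w)) ` \<Gamma>. cinner t v = c" for z
  proof (rule riesz_representation_graph[where C = "C * norm z"])
    show "(\<lambda>(v, w). (v, cinner z w)) ` \<Gamma> \<noteq> {}"
      using dense by auto
  qed (use add scale bd in \<open>(force simp: cinner_add_right[symmetric] cinner_scaleC_right[symmetric])+\<close>)
  then obtain S where "\<And>z. \<forall>(v, c)\<in>(\<lambda>(v, w). (v, cinner z w)) ` \<Gamma>. cinner (S z) v = c"
    by metis
  then have S: "cinner (S z) v = cinner z w" if "(v, w) \<in> \<Gamma>" for z v w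
    using that by fastforce
  have S_add: "S (x + y) = S x + S y" for x y
    by (rule cinner_dense_eqI[OF dense]) (auto simp: S cinner_add_left)
  have S_scale: "S (c *\<^sub>C x) = c *\<^sub>C S x" for c x
    by (rule cinner_dense_eqI[OF dense]) (auto simp: S cinner_scaleC_left)
  have "norm (S z) \<le> norm z * C" for z
    using bd \<open>C \<ge> 0\<close> by (intro cinner_le_imp_norm_le[OF dense]) (auto simp: S mult.commute)
  then have "bounded_linear S"
    by (intro bounded_linear_intro[where K = C]) (simp_all add: S_add S_scale scaleR_scaleC)
  then show thesis
    using S S_add S_scale
    by (intro that[of "Blinfun S"]) (simp_all add: bounded_ops_def clinear_iff bounded_linear_Blinfun_apply)
qed

lemma bounded_ops_iff: "T \<in> bounded_ops \<longleftrightarrow> (\<forall>c x. T (c *\<^sub>C x) = c *\<^sub>C T x)"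
  by (auto simp: bounded_ops_def clinear_iff blinfun.add_right)

text \<open>Existence comes from \<open>adjoint_graph\<close> and uniqueness from testing against
  all vectors, so the definite description in \<open>adj\<close> denotes.\<close>

lemma
  assumes T: "T \<in> bounded_ops"
  shows cinner_adj_left: "cinner (adj T y) x = cinner y (T x)"
    and adj_bounded_ops: "adj T \<in> bounded_ops"
proof -
  let ?P = "\<lambda>S. \<forall>x y. cinner (blinfun_apply S y) x = cinner y (T x)"
  obtain S where S: "S \<in> bounded_ops"
    "\<And>z v w. (v, w) \<in> range (\<lambda>x. (x, T x)) \<Longrightarrow> cinner (S z) v = cinner z w"
  proof (rule adjoint_graph[where \<Gamma> = "range (\<lambda>x. (x, T x))" and C = "norm T"])
    show "closure (fst ` range (\<lambda>x. (x, T x))) = UNIV"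
      by (simp add: image_image)
  qed (use T in \<open>auto simp: bounded_ops_iff blinfun.add_right norm_blinfun\<close>)
  have "?P S" using S(2) by auto
  moreover have "S' = S" if "?P S'" for S'
    using that \<open>?P S\<close> by (intro blinfun_eqI cinner_dense_eqI[of UNIV]) simp_all
  ultimately have "adj T = S"
    unfolding adj_def by (intro the_equality) blast+
  then show "cinner (adj T y) x = cinner y (T x)" "adj T \<in> bounded_ops"
    using S \<open>?P S\<close> by simp_all
qed

lemma cinner_adj_right:
  assumes "T \<in> bounded_ops"
  shows "cinner x (adj T y) = cinner (T x) y"
  using cinner_adj_left[OF assms, of y x] by (metis cinner_commute)


lemma scaleR_scaleC_commute: "r *\<^sub>R c *\<^sub>C x = c *\<^sub>C r *\<^sub>R (x :: 'a::complex_vector)"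
  by (simp add: scaleR_scaleC scaleC_scaleC mult.commute)

lemma bounded_ops_0: "0 \<in> bounded_ops"
  and bounded_ops_id: "id_blinfun \<in> bounded_ops"
  and bounded_ops_add: "S \<in> bounded_ops \<Longrightarrow> T \<in> bounded_ops \<Longrightarrow> S + T \<in> bounded_ops"
  and bounded_ops_diff: "S \<in> bounded_ops \<Longrightarrow> T \<in> bounded_ops \<Longrightarrow> S - T \<in> bounded_ops"
  and bounded_ops_scaleR: "S \<in> bounded_ops \<Longrightarrow> r *\<^sub>R S \<in> bounded_ops"
  and bounded_ops_compose: "A \<in> bounded_ops \<Longrightarrow> B \<in> bounded_ops \<Longrightarrow> A o\<^sub>L B \<in> bounded_ops"
  by (auto simp: bounded_ops_iff blinfun.bilinear_simps scaleC_add_right cvs.scale_right_diff_distrib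
      scaleR_scaleC_commute)

lemma unitary_adj_apply:
  assumes "unitary U"
  shows "adj U (U x) = x"
  using assms unfolding unitary_def by (metis blinfun_apply_blinfun_compose id_blinfun.rep_eq id_apply)

section \<open>The order on operators\<close>

text \<open>An order embedding of a partially ordered set is injective by reflexivity and
  antisymmetry. Convexity and the partial order of \<open>D\<close> are carried over from
  \<open>C\<close> along \<open>F\<close>, so neither has to be checked separately for maps.\<close>

lemma affine_order_isoI:
  assumes C: "ordered_convex_set C leq\<^sub>C" and D: "F ` C = D"
    and aff: "\<And>x y t. x \<in> C \<Longrightarrow> y \<in> C \<Longrightarrow> t \<in> {0..1} \<Longrightarrow>
        F ((1 - t) *\<^sub>R x + t *\<^sub>R y) = (1 - t) *\<^sub>R F x + t *\<^sub>R F y"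
    and iff: "\<And>x y. x \<in> C \<Longrightarrow> y \<in> C \<Longrightarrow> leq\<^sub>C x y \<longleftrightarrow> leq\<^sub>D (F x) (F y)"
  shows "affine_order_iso C leq\<^sub>C D leq\<^sub>D F"
proof -
  have conv: "(1 - t) *\<^sub>R x + t *\<^sub>R y \<in> C" if "x \<in> C" "y \<in> C" "t \<in> {0..1}" for x y t
    using C that by (auto simp: ordered_convex_set_def convex_alt)
  have refl: "leq\<^sub>C x x" if "x \<in> C" for x
    using C that
    by (auto simp: ordered_convex_set_def partial_order_on_def preorder_on_def refl_on_def)
  have anti: "x = y" if "x \<in> C" "y \<in> C" "leq\<^sub>C x y" "leq\<^sub>C y x" for x y
    using C that by (auto simp: ordered_convex_set_def partial_order_on_def antisym_def)
  have trans: "leq\<^sub>C x z" if "x \<in> C" "y \<in> C" "z \<in> C" "leq\<^sub>C x y" "leq\<^sub>C y z" for x y z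
    using C that
    unfolding ordered_convex_set_def partial_order_on_def preorder_on_def trans_def by blast
  have "inj_on F C"
    by (rule inj_onI) (metis anti iff refl)
  moreover have "convex D"
    unfolding convex_alt D[symmetric]
    by (auto simp: aff[symmetric] intro!: imageI conv)
  moreover have "partial_order_on D {(x, y). x \<in> D \<and> y \<in> D \<and> leq\<^sub>D x y}"
    unfolding partial_order_on_def preorder_on_def D[symmetric]
    by (auto simp: refl_on_def trans_def antisym_def iff[symmetric] intro: refl trans)
      (metis anti)+
  ultimately show ?thesis
    using C D aff iff by (simp add: affine_order_iso_def ordered_convex_set_def bij_betw_def)
qed

text \<open>Polarisation: the quadratic form of \<open>T\<close> vanishes, and its values at x + y
  and x + \<i> y force the sesquilinear form to vanish.\<close>

lemma positive_op_zero_form: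
  assumes "positive_op T" "positive_op (- T)"
  shows "T = 0"
proof -
  have T: "T (c *\<^sub>C x) = c *\<^sub>C T x" for c x
    using assms by (simp add: positive_op_def bounded_ops_iff)
  have diag: "cinner x (T x) = 0" for x
  proof -
    have "cinner x (T x) \<in> \<real>\<^sub>\<ge>\<^sub>0" "- cinner x (T x) \<in> \<real>\<^sub>\<ge>\<^sub>0"
      using assms by (simp_all add: positive_op_def blinfun.minus_left cinner.minus_right)
    then show ?thesis by (simp add: complex_nonneg_Reals_iff complex_eq_iff)
  qed
  have "cinner x (T y) = 0" for x y
  proof -
    have "cinner x (T y) + cinner y (T x) = 0"
      using diag[of "x + y"] diag[of x] diag[of y]
by (simp add: blinfun.add_right cinner_add_left cinner_add_right add.commute)
    moreover have "\<i> * cinner x (T y) - \<i> * cinner y (T x) = 0"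
      using diag[of "x + \<i> *\<^sub>C y"] diag[of x] diag[of y]
      by (simp add: T blinfun.add_right cinner_add_left cinner_add_right
          cinner_scaleC_left cinner_scaleC_right)
    ultimately show ?thesis by (simp add: complex_eq_iff)
  qed
  then show ?thesis
    by (intro blinfun_eqI cinner_eqI) (simp add: cinner.zero_right)
qed

lemma positive_op_add: "positive_op S \<Longrightarrow> positive_op T \<Longrightarrow> positive_op (S + T)"
  by (simp add: positive_op_def bounded_ops_add blinfun.add_left cinner_add_right)

lemma positive_op_scaleR: "0 \<le> r \<Longrightarrow> positive_op T \<Longrightarrow> positive_op (r *\<^sub>R T)"
  by (simp add: positive_op_def bounded_ops_scaleR blinfun.scaleR_left cinner.scaleR_right
      complex_nonneg_Reals_iff)

lemma op_le_refl: "op_le T T"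
  by (simp add: op_le_def positive_op_def bounded_ops_0 cinner.zero_right)

lemma op_le_trans: "op_le R S \<Longrightarrow> op_le S T \<Longrightarrow> op_le R T"
  using positive_op_add[of "S - R" "T - S"] by (simp add: op_le_def)

lemma op_le_antisym: "op_le S T \<Longrightarrow> op_le T S \<Longrightarrow> S = T"
  using positive_op_zero_form[of "T - S"] by (simp add: op_le_def)

section \<open>Commutants and their order intervals\<close>

lemma commutant_bounded_ops: "T \<in> commutant M \<Longrightarrow> T \<in> bounded_ops"
  by (simp add: commutant_def)

lemma commutant_commute: "T \<in> commutant M \<Longrightarrow> S \<in> M \<Longrightarrow> T (blinfun_apply S x) = S (T x)"
  unfolding commutant_def by (metis (mono_tags, lifting) blinfun_apply_blinfun_compose mem_Collect_eq)

lemma commutantI: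
  "T \<in> bounded_ops \<Longrightarrow> (\<And>S x. S \<in> M \<Longrightarrow> T (blinfun_apply S x) = S (T x)) \<Longrightarrow> T \<in> commutant M"
  by (auto simp: commutant_def intro!: blinfun_eqI)

lemma commutant_antimono: "M \<subseteq> N \<Longrightarrow> commutant N \<subseteq> commutant M"
  by (auto simp: commutant_def)

lemma
  assumes "S \<in> commutant M" "T \<in> commutant M"
  shows commutant_add: "S + T \<in> commutant M"
    and commutant_diff: "S - T \<in> commutant M"
  using assms[THEN commutant_bounded_ops] commutant_commute[OF assms(1)] commutant_commute[OF assms(2)]
  by (auto intro!: commutantI bounded_ops_add bounded_ops_diff simp: blinfun.bilinear_simps)

lemma commutant_scaleR: "T \<in> commutant M \<Longrightarrow> r *\<^sub>R T \<in> commutant M"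
  using commutant_commute[of T M] commutant_bounded_ops[of T M]
  by (auto intro!: commutantI bounded_ops_scaleR simp: blinfun.bilinear_simps)

lemma commutant_id: "id_blinfun \<in> commutant M"
  by (rule commutantI) (simp_all add: bounded_ops_id)

lemma ordered_convex_commutant_interval:
  "ordered_convex_set {T \<in> commutant M. op_le 0 T \<and> op_le T id_blinfun} op_le"
proof -
  have "(1 - t) *\<^sub>R S + t *\<^sub>R T \<in> {T \<in> commutant M. op_le 0 T \<and> op_le T id_blinfun}"
    if S: "S \<in> commutant M" "op_le 0 S" "op_le S id_blinfun"
      and T: "T \<in> commutant M" "op_le 0 T" "op_le T id_blinfun" and t: "0 \<le> t" "t \<le> 1"
    for S T and t :: real
  proof -
    have "positive_op ((1 - t) *\<^sub>R S + t *\<^sub>R T)"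
      using S T t by (intro positive_op_add positive_op_scaleR) (simp_all add: op_le_def)
    \<comment> \<open>The distance of a convex combination to the identity is the same combination
      of the distances.\<close>
    moreover have "positive_op ((1 - t) *\<^sub>R (id_blinfun - S) + t *\<^sub>R (id_blinfun - T))"
      using S T t by (intro positive_op_add positive_op_scaleR) (simp_all add: op_le_def)
    moreover have "(1 - t) *\<^sub>R (id_blinfun - S) + t *\<^sub>R (id_blinfun - T)
        = id_blinfun - ((1 - t) *\<^sub>R S + t *\<^sub>R T)"
      by (simp add: algebra_simps)
    ultimately show ?thesis
      using S T by (simp add: op_le_def commutant_add commutant_scaleR)
  qed
  then show ?thesis
    unfolding ordered_convex_set_def convex_alt partial_order_on_def preorder_on_def
    by (auto simp: refl_on_def trans_def antisym_def intro: op_le_refl op_le_trans op_le_antisym)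
qed

section \<open>The kernel of a completely positive map\<close>

text \<open>A list of pairs \<open>(a, h)\<close> stands for the formal sum of the elementary tensors \<open>a \<otimes> h\<close>.\<close>

definition kernel ::
    "('a::unital_cstar_algebra \<Rightarrow> 'h::complex_hilbert_space \<Rightarrow>\<^sub>L 'h) \<Rightarrow> ('a \<times> 'h) list \<Rightarrow> ('a \<times> 'h) list \<Rightarrow> complex"
  where "kernel \<theta> xs ys = (\<Sum>(a, h)\<leftarrow>xs. \<Sum>(b, k)\<leftarrow>ys. cinner h (\<theta> (star a * b) k))"

text \<open>The scalar is put on the Hilbert space factor, so homogeneity of \<open>kernel\<close>
  comes from \<open>cinner\<close> and from the complex linearity of each operator
  \<open>\<theta> a\<close>.\<close>

definition scale_tensor :: "complex \<Rightarrow> ('a \<times> 'h::complex_vector) list \<Rightarrow> ('a \<times> 'h) list"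
  where "scale_tensor c = map (\<lambda>(a, h). (a, c *\<^sub>C h))"

lemma scale_tensor_simps [simp]:
  "scale_tensor c [] = []"
  "scale_tensor c ((a, h) # xs) = (a, c *\<^sub>C h) # scale_tensor c xs"
  by (simp_all add: scale_tensor_def)

lemma kernel_append_left: "kernel \<theta> (xs @ xs') ys = kernel \<theta> xs ys + kernel \<theta> xs' ys"
  by (simp add: kernel_def)

lemma kernel_append_right: "kernel \<theta> xs (ys @ ys') = kernel \<theta> xs ys + kernel \<theta> xs ys'"
  by (induction xs) (auto simp: kernel_def)

lemma kernel_scale_left: "kernel \<theta> (scale_tensor c xs) ys = cnj c * kernel \<theta> xs ys"
proof -
  have "(\<Sum>(b, k)\<leftarrow>ys. cinner (c *\<^sub>C h) (\<theta> (star a * b) k))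
      = cnj c * (\<Sum>(b, k)\<leftarrow>ys. cinner h (\<theta> (star a * b) k))" for a h
    by (induction ys) (auto simp: cinner_scaleC_left algebra_simps)
  then show ?thesis
    by (induction xs) (auto simp: kernel_def algebra_simps)
qed

lemma kernel_scale_right:
  assumes "range \<theta> \<subseteq> bounded_ops"
  shows "kernel \<theta> xs (scale_tensor c ys) = c * kernel \<theta> xs ys"
proof -
  have "\<theta> a (c *\<^sub>C k) = c *\<^sub>C \<theta> a k" for a k
    using assms by (metis bounded_ops_iff range_subsetD)
  then have "(\<Sum>(b, k)\<leftarrow>scale_tensor c ys. cinner h (\<theta> (star a * b) k))
      = c * (\<Sum>(b, k)\<leftarrow>ys. cinner h (\<theta> (star a * b) k))" for a h
    by (induction ys) (auto simp: cinner_scaleC_right algebra_simps)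
  then show ?thesis
    by (induction xs) (auto simp: kernel_def algebra_simps)
qed

lemma kernel_diff: "kernel (\<phi> - \<theta>) xs ys = kernel \<phi> xs ys - kernel \<theta> xs ys"
proof -
  have "(\<Sum>(b, k)\<leftarrow>ys. cinner h ((\<phi> - \<theta>) (star a * b) k))
      = (\<Sum>(b, k)\<leftarrow>ys. cinner h (\<phi> (star a * b) k)) - (\<Sum>(b, k)\<leftarrow>ys. cinner h (\<theta> (star a * b) k))" for a h
    by (induction ys) (auto simp: blinfun.diff_left cinner.diff_right)
  then show ?thesis
    by (induction xs) (auto simp: kernel_def)
qed

lemma star_0: "star 0 = 0"
  using star_scaleC[of 0 0] by simp

text \<open>The diagonal of the form is complete positivity tested on the Gram matrix of the algebra
  elements in the list.\<close>

lemma kernel_nonneg: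
  assumes "completely_positive \<theta>"
  shows "kernel \<theta> xs xs \<in> \<real>\<^sub>\<ge>\<^sub>0"
proof -
  define n where "n = length xs"
  define a where "a i = fst (xs ! i)" for i
  define h where "h i = snd (xs ! i)" for i
  have "positive_matrix n (\<lambda>i j. star (a i) * a j)"
    unfolding positive_matrix_def
  proof (intro exI allI impI)
    fix i j assume "i < n" "j < n"
    \<comment> \<open>The Gram matrix is \<open>x\<^sup>* x\<close> for the square matrix
      \<open>x\<close> whose row 0 consists of the \<open>a j\<close> and whose other rows vanish;
      \<open>i < n\<close> ensures that row 0 exists.\<close>
    have "(\<Sum>k<n. star (if k = 0 then a i else 0) * (if k = 0 then a j else 0))
        = (\<Sum>k<n. if k = 0 then star (a i) * a j else 0)"
      by (intro sum.cong) (auto simp: star_0)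
    also have "\<dots> = star (a i) * a j"
      using \<open>i < n\<close> by (simp add: sum.delta)
    finally show "star (a i) * a j
        = (\<Sum>k<n. star (if k = 0 then a i else 0) * (if k = 0 then a j else 0))" ..
  qed
  then have "positive_op_matrix n (\<lambda>i j. \<theta> (star (a i) * a j))"
    using assms by (auto simp: completely_positive_def)
  then have "(\<Sum>i<n. cinner (h i) (\<Sum>j<n. \<theta> (star (a i) * a j) (h j))) \<in> \<real>\<^sub>\<ge>\<^sub>0"
    by (simp add: positive_op_matrix_def)
  also have "(\<Sum>i<n. cinner (h i) (\<Sum>j<n. \<theta> (star (a i) * a j) (h j))) = kernel \<theta> xs xs"
    by (simp add: kernel_def sum_list_sum_nth atLeast0LessThan n_def a_def h_def case_prod_unfold
        cinner.sum_right)
  finally show ?thesis .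
qed

text \<open>Concatenation adds tensors, so \<open>xs @ scale_tensor c ys\<close> takes the place of
  x + c y.\<close>

lemma kernel_cauchy_schwarz:
  assumes "completely_positive \<theta>"
  shows "(cmod (kernel \<theta> xs ys))\<^sup>2 \<le> Re (kernel \<theta> xs xs) * Re (kernel \<theta> ys ys)"
proof -
  have "range \<theta> \<subseteq> bounded_ops" using assms by (simp add: completely_positive_def)
  then have "kernel \<theta> xs xs + c * kernel \<theta> xs ys + cnj c * kernel \<theta> ys xs
      + c * cnj c * kernel \<theta> ys ys \<in> \<real>\<^sub>\<ge>\<^sub>0" for c
    using kernel_nonneg[OF assms, of "xs @ scale_tensor c ys"]
    by (simp add: kernel_append_left kernel_append_right kernel_scale_left kernel_scale_right algebra_simps)
  from cauchy_schwarz_coefficients[OF this kernel_nonneg[OF assms] kernel_nonneg[OF assms]]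
  show "(cmod (kernel \<theta> xs ys))\<^sup>2 \<le> Re (kernel \<theta> xs xs) * Re (kernel \<theta> ys ys)" .
qed


section \<open>Compressions of a dilation\<close>

text \<open>The dilated map is not a parameter: it is recovered as
  \<open>compress id_blinfun\<close>, which puts \<phi> and all \<open>\<phi>_T\<close> on the same
  footing.\<close>

locale stinespring_dilation =
  fixes V :: "'h::complex_hilbert_space \<Rightarrow>\<^sub>L 'k::complex_hilbert_space"
    and \<rho> :: "'a::unital_cstar_algebra \<Rightarrow> 'k \<Rightarrow>\<^sub>L 'k"
  assumes V: "V \<in> bounded_ops"
    and rep: "unital_star_rep \<rho>"
    and minimal: "closure (cvs.span {\<rho> a (V h) | a h. True}) = UNIV"
begin

definition compress :: "('k \<Rightarrow>\<^sub>L 'k) \<Rightarrow> 'a \<Rightarrow> 'h \<Rightarrow>\<^sub>L 'h"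
  where "compress T = (\<lambda>a. adj V o\<^sub>L \<rho> a o\<^sub>L T o\<^sub>L V)"

definition tensor_map :: "('a \<times> 'h) list \<Rightarrow> 'k"
  where "tensor_map xs = (\<Sum>(a, h)\<leftarrow>xs. \<rho> a (V h))"

lemma V_scaleC: "V (c *\<^sub>C h) = c *\<^sub>C V h"
  using V by (simp add: bounded_ops_iff)

lemma rho_bounded_ops: "\<rho> a \<in> bounded_ops"
  using rep by (auto simp: unital_star_rep_def)

lemma rho_scaleC_right: "\<rho> a (c *\<^sub>C x) = c *\<^sub>C \<rho> a x"
  using rho_bounded_ops[of a] by (simp add: bounded_ops_iff)

lemma rho_add: "\<rho> (a + b) = \<rho> a + \<rho> b"
  and rho_scaleC: "\<rho> (c *\<^sub>C a) = c *\<^sub>C \<rho> a"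
  using rep by (simp_all add: unital_star_rep_def clinear_iff)

lemma rho_mult: "\<rho> (a * b) x = \<rho> a (\<rho> b x)"
  using rep by (simp add: unital_star_rep_def)

lemma cinner_rho_star: "cinner x (\<rho> (star a) y) = cinner (\<rho> a x) y"
  using rep by (simp add: unital_star_rep_def cinner_adj_right rho_bounded_ops)

lemma compress_apply: "compress T a h = adj V (\<rho> a (T (V h)))"
  by (simp add: compress_def)

lemma cinner_compress: "cinner h (compress T a k) = cinner (V h) (\<rho> a (T (V k)))"
  by (simp add: compress_apply cinner_adj_right V)

text \<open>Moving \<open>T\<close> past \<open>\<rho> b\<close> turns \<open>compress T\<close>
  into the form of \<open>T\<close> on the vectors \<open>\<rho> a (V h)\<close>.\<close>

lemma cinner_compress_star_mult:
  assumes "T \<in> commutant (range \<rho>)"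
  shows "cinner h (compress T (star a * b) k) = cinner (\<rho> a (V h)) (T (\<rho> b (V k)))"
  by (simp add: cinner_compress rho_mult cinner_rho_star commutant_commute[OF assms, of "\<rho> b"])

lemma compress_diff: "compress (S - T) = compress S - compress T"
  by (auto simp: fun_eq_iff compress_apply blinfun.bilinear_simps intro!: blinfun_eqI)

lemma compress_convex_comb:
  "compress ((1 - t) *\<^sub>R S + t *\<^sub>R T) = (1 - t) *\<^sub>R compress S + t *\<^sub>R compress T"
  by (auto simp: fun_eq_iff scaleR_fun_def compress_apply blinfun.bilinear_simps intro!: blinfun_eqI)

lemma clinear_compress: "clinear (compress T)"
  using adj_bounded_ops[OF V]
  by (auto simp: clinear_iff compress_apply rho_add rho_scaleC blinfun.bilinear_simps
      scaleC_blinfun.rep_eq bounded_ops_iff intro!: blinfun_eqI)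

lemma compress_bounded_ops: "T \<in> bounded_ops \<Longrightarrow> compress T a \<in> bounded_ops"
  unfolding compress_def
  by (intro bounded_ops_compose adj_bounded_ops V rho_bounded_ops)

lemma compress_sum: "compress T (\<Sum>k<(n::nat). f k) = (\<Sum>k<n. compress T (f k))"
proof -
  have add: "compress T (a + b) = compress T a + compress T b" for a b
    using clinear_compress by (simp add: clinear_iff)
  have "compress T 0 = 0"
    using add[of 0 0] by simp
  then show ?thesis
    by (induction n) (simp_all add: add)
qed

lemma completely_positive_compress:
  assumes comm: "T \<in> commutant (range \<rho>)" and pos: "positive_op T"
  shows "completely_positive (compress T)"
proof -
  have T: "T \<in> bounded_ops" using comm by (rule commutant_bounded_ops)
  have "positive_op_matrix n (\<lambda>i j. compress T (a i j))" if a: "positive_matrix n a" for n a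
  proof -
    obtain x where x: "\<And>i j. i < n \<Longrightarrow> j < n \<Longrightarrow> a i j = (\<Sum>k<n. star (x k i) * x k j)"
      using a by (auto simp: positive_matrix_def)
    have "(\<Sum>i<n. cinner (h i) (\<Sum>j<n. compress T (a i j) (h j))) \<in> \<real>\<^sub>\<ge>\<^sub>0" for h
    proof -
      \<comment> \<open>One vector for each row of \<open>x\<close>: the matrix form splits into the
        sum of the values of the quadratic form of \<open>T\<close> at these vectors.\<close>
      define v where "v k = (\<Sum>i<n. \<rho> (x k i) (V (h i)))" for k
      let ?f = "\<lambda>i j k. cinner (\<rho> (x k i) (V (h i))) (T (\<rho> (x k j) (V (h j))))"
      have "(\<Sum>i<n. cinner (h i) (\<Sum>j<n. compress T (a i j) (h j))) = (\<Sum>i<n. \<Sum>j<n. \<Sum>k<n. ?f i j k)"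
        by (intro sum.cong refl)
          (simp add: x compress_sum blinfun.sum_left cinner.sum_right cinner_compress_star_mult comm)
      also have "\<dots> = (\<Sum>i<n. \<Sum>k<n. \<Sum>j<n. ?f i j k)"
        by (intro sum.cong refl sum.swap)
      also have "\<dots> = (\<Sum>k<n. \<Sum>i<n. \<Sum>j<n. ?f i j k)"
        by (rule sum.swap)
      also have "\<dots> = (\<Sum>k<n. cinner (v k) (T (v k)))"
        by (simp add: v_def blinfun.sum_right cinner.sum_left cinner.sum_right)
          (intro sum.cong refl sum.swap)
      also have "\<dots> \<in> \<real>\<^sub>\<ge>\<^sub>0"
        using pos by (auto simp: positive_op_def complex_nonneg_Reals_iff intro!: sum_nonneg sum.neutral)
      finally show ?thesis .
    qed
    then show ?thesis
      by (simp add: positive_op_matrix_def compress_bounded_ops T)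
  qed
  then show ?thesis
    by (auto simp: completely_positive_def compress_bounded_ops T clinear_compress)
qed

section \<open>The form of an operator on formal tensors\<close>

lemma tensor_map_append: "tensor_map (xs @ ys) = tensor_map xs + tensor_map ys"
  by (simp add: tensor_map_def)

lemma tensor_map_scale: "tensor_map (scale_tensor c xs) = c *\<^sub>C tensor_map xs"
  by (induction xs) (auto simp: tensor_map_def V_scaleC rho_scaleC_right scaleC_add_right)

lemma tensor_map_Cons: "tensor_map ((a, h) # xs) = \<rho> a (V h) + tensor_map xs"
  and tensor_map_Nil: "tensor_map [] = 0"
  by (simp_all add: tensor_map_def)

lemma tensor_map_dense: "closure (range tensor_map) = UNIV"
proof -
  have "cvs.subspace (range tensor_map)"
    by (rule cvs.subspaceI)
      (auto simp flip: tensor_map_append tensor_map_scale tensor_map_Nil)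
  moreover have "{\<rho> a (V h) | a h. True} \<subseteq> range tensor_map"
  proof clarify
    fix a h
    show "\<rho> a (V h) \<in> range tensor_map"
      by (rule range_eqI[of _ _ "[(a, h)]"]) (simp add: tensor_map_Cons tensor_map_Nil)
  qed
  ultimately have "cvs.span {\<rho> a (V h) | a h. True} \<subseteq> range tensor_map"
    by (intro cvs.span_minimal)
  then show ?thesis
    using minimal closure_mono by blast
qed

text \<open>For \<open>T = id_blinfun\<close> the right-hand side is the inner product of the
  images, which is how domination by \<phi> becomes a norm bound in
  \<open>kernel_operator\<close>.\<close>

lemma kernel_compress:
  assumes "T \<in> commutant (range \<rho>)"
  shows "kernel (compress T) xs ys = cinner (tensor_map xs) (T (tensor_map ys))"
proof -
  have "(\<Sum>(b, k)\<leftarrow>ys. cinner h (compress T (star a * b) k)) = cinner (\<rho> a (V h)) (T (tensor_map ys))" for a h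
    by (induction ys)
      (auto simp: tensor_map_Cons tensor_map_Nil cinner_compress_star_mult[OF assms]
        blinfun.bilinear_simps cinner_add_right cinner.zero_right)
  then show ?thesis
    by (induction xs)
      (auto simp: kernel_def tensor_map_Cons tensor_map_Nil cinner_add_left cinner.zero_left)
qed

text \<open>Complete positivity makes the quadratic form of \<open>T\<close> nonnegative on the
  dense range of \<open>tensor_map\<close>; nonnegativity is a closed condition.\<close>

lemma completely_positive_compress_iff:
  assumes comm: "T \<in> commutant (range \<rho>)"
  shows "completely_positive (compress T) \<longleftrightarrow> positive_op T"
proof
  assume cp: "completely_positive (compress T)"
  have "closed {x. cinner x (T x) \<in> \<real>\<^sub>\<ge>\<^sub>0}"
  proof -
    have "{x. cinner x (T x) \<in> \<real>\<^sub>\<ge>\<^sub>0} = {x. 0 \<le> Re (cinner x (T x))} \<inter> {x. Im (cinner x (T x)) = 0}"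
      by (auto simp: complex_nonneg_Reals_iff)
    moreover have "closed \<dots>"
      by (intro closed_Int closed_Collect_le closed_Collect_eq continuous_intros cinner.continuous_on)
    ultimately show ?thesis by simp
  qed
  moreover have "range tensor_map \<subseteq> {x. cinner x (T x) \<in> \<real>\<^sub>\<ge>\<^sub>0}"
    using kernel_nonneg[OF cp] by (auto simp: kernel_compress[OF comm])
  ultimately have "{x. cinner x (T x) \<in> \<real>\<^sub>\<ge>\<^sub>0} = UNIV"
    using tensor_map_dense by (metis closure_minimal top.extremum_uniqueI)
  then show "positive_op T"
    using comm by (auto simp: positive_op_def commutant_bounded_ops)
qed (rule completely_positive_compress[OF comm])

section \<open>The operator of a dominated completely positive map\<close>

text \<open>Different lists may have the same image under \<open>tensor_map\<close>. Both the
  functionals and the operator are therefore given by graphs, and \<open>bound\<close> is what makes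
  them single-valued.\<close>

lemma kernel_operator:
  assumes cp: "completely_positive \<theta>" and le: "completely_positive (compress id_blinfun - \<theta>)"
  obtains T where "T \<in> bounded_ops"
    "\<And>xs ys. cinner (tensor_map xs) (T (tensor_map ys)) = kernel \<theta> xs ys"
proof -
  have diag: "Re (kernel \<theta> xs xs) \<le> (norm (tensor_map xs))\<^sup>2" for xs
    using kernel_nonneg[OF le, of xs]
    by (simp add: kernel_diff kernel_compress commutant_id cinner_self complex_nonneg_Reals_iff)
  have bound: "cmod (kernel \<theta> xs ys) \<le> norm (tensor_map xs) * norm (tensor_map ys)" for xs ys
  proof (rule power2_le_imp_le)
    have "(cmod (kernel \<theta> xs ys))\<^sup>2 \<le> Re (kernel \<theta> xs xs) * Re (kernel \<theta> ys ys)"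
      by (rule kernel_cauchy_schwarz[OF cp])
    also have "\<dots> \<le> (norm (tensor_map xs))\<^sup>2 * (norm (tensor_map ys))\<^sup>2"
      using kernel_nonneg[OF cp] by (intro mult_mono diag) (auto simp: complex_nonneg_Reals_iff)
    finally show "(cmod (kernel \<theta> xs ys))\<^sup>2 \<le> (norm (tensor_map xs) * norm (tensor_map ys))\<^sup>2"
      by (simp add: power_mult_distrib)
  qed simp
  have ops: "range \<theta> \<subseteq> bounded_ops" using cp by (simp add: completely_positive_def)
  \<comment> \<open>The graph of the densely defined contraction sending
    \<open>tensor_map ys\<close> to the Riesz vector of \<open>kernel \<theta> ys\<close>; the
    required \<open>T\<close> is its adjoint.\<close>
  define \<Gamma> where "\<Gamma> = {(tensor_map ys, w) | ys w. \<forall>xs. cinner w (tensor_map xs) = kernel \<theta> ys xs}"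
  have rep: "\<exists>w. \<forall>xs. cinner w (tensor_map xs) = kernel \<theta> ys xs" for ys
  proof -
    have "\<exists>w. \<forall>(v, c) \<in> range (\<lambda>xs. (tensor_map xs, kernel \<theta> ys xs)). cinner w v = c"
    proof (rule riesz_representation_graph[where C = "norm (tensor_map ys)"])
      fix v c v' c'
      assume "(v, c) \<in> range (\<lambda>xs. (tensor_map xs, kernel \<theta> ys xs))"
        "(v', c') \<in> range (\<lambda>xs. (tensor_map xs, kernel \<theta> ys xs))"
      then show "(v + v', c + c') \<in> range (\<lambda>xs. (tensor_map xs, kernel \<theta> ys xs))"
        by (auto simp flip: tensor_map_append kernel_append_right)
    next
      fix v c s
      assume "(v, c) \<in> range (\<lambda>xs. (tensor_map xs, kernel \<theta> ys xs))"
      then show "(s *\<^sub>C v, s * c) \<in> range (\<lambda>xs. (tensor_map xs, kernel \<theta> ys xs))"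
        by (auto simp flip: tensor_map_scale kernel_scale_right[OF ops])
    qed (auto simp: bound)
    then show ?thesis by auto
  qed
  then have "range tensor_map \<subseteq> fst ` \<Gamma>"
    unfolding \<Gamma>_def by force
  then have dense: "closure (fst ` \<Gamma>) = UNIV"
    using closure_mono tensor_map_dense by blast
  obtain T where T: "T \<in> bounded_ops"
    and T_eq: "\<And>z v w. (v, w) \<in> \<Gamma> \<Longrightarrow> cinner (T z) v = cinner z w"
  proof (rule adjoint_graph[OF dense, where C = 1])
    fix v w v' w'
    assume "(v, w) \<in> \<Gamma>" "(v', w') \<in> \<Gamma>"
    then show "(v + v', w + w') \<in> \<Gamma>"
      unfolding \<Gamma>_def mem_Collect_eq prod.inject
      by (metis tensor_map_append kernel_append_left cinner_add_left)
  next
    fix v w s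
    assume "(v, w) \<in> \<Gamma>"
    then obtain ys where ys: "v = tensor_map ys" "\<And>xs. cinner w (tensor_map xs) = kernel \<theta> ys xs"
      by (auto simp: \<Gamma>_def)
    then have "s *\<^sub>C v = tensor_map (scale_tensor s ys)"
      "\<And>xs. cinner (s *\<^sub>C w) (tensor_map xs) = kernel \<theta> (scale_tensor s ys) xs"
      by (simp_all add: tensor_map_scale kernel_scale_left cinner_scaleC_left)
    then show "(s *\<^sub>C v, s *\<^sub>C w) \<in> \<Gamma>"
      unfolding \<Gamma>_def by blast
  next
    fix v w
    assume "(v, w) \<in> \<Gamma>"
    then show "norm w \<le> 1 * norm v"
      by (auto simp: \<Gamma>_def bound intro!: cinner_le_imp_norm_le[OF tensor_map_dense])
  qed auto
  have "cinner (tensor_map xs) (T (tensor_map ys)) = kernel \<theta> xs ys" for xs ys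
  proof -
    obtain w where w: "\<And>us. cinner w (tensor_map us) = kernel \<theta> xs us"
      using rep by blast
    then have "(tensor_map xs, w) \<in> \<Gamma>"
      unfolding \<Gamma>_def by blast
    then have "cinner (tensor_map xs) (T (tensor_map ys)) = cinner w (tensor_map ys)"
      using T_eq cinner_commute by metis
    then show ?thesis by (simp add: w)
  qed
  with T show thesis by (rule that)
qed

text \<open>Additivity in each argument extends the equality to sums of the vectors
  \<open>\<rho> a (V h)\<close>; density on the left and continuity of \<open>X\<close> and
  \<open>Y\<close> on the right do the rest.\<close>

lemma operator_eqI:
  assumes eq: "\<And>a h b k. cinner (\<rho> a (V h)) (blinfun_apply X (\<rho> b (V k))) = cinner (\<rho> a (V h)) (blinfun_apply Y (\<rho> b (V k)))"
  shows "X = Y"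
proof -
  have left: "cinner (tensor_map xs) (X (\<rho> b (V k))) = cinner (tensor_map xs) (Y (\<rho> b (V k)))" for xs b k
    by (induction xs) (auto simp: tensor_map_Cons tensor_map_Nil cinner_add_left eq cinner.zero_left)
  have "X (\<rho> b (V k)) = Y (\<rho> b (V k))" for b k
  proof (rule cinner_dense_eqI[OF tensor_map_dense])
    fix d assume "d \<in> range tensor_map"
    then show "cinner (X (\<rho> b (V k))) d = cinner (Y (\<rho> b (V k))) d"
      using left by (metis cinner_commute rangeE)
  qed
  then have "X (tensor_map ys) = Y (tensor_map ys)" for ys
    by (induction ys) (auto simp: tensor_map_Cons tensor_map_Nil blinfun.bilinear_simps)
  moreover have "closed {x. X x = Y x}"
    by (intro closed_Collect_eq continuous_intros)
  ultimately have "closure (range tensor_map) \<subseteq> {x. X x = Y x}"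
    by (intro closure_minimal) auto
  then show ?thesis
    by (intro blinfun_eqI) (auto simp: tensor_map_dense)
qed

text \<open>Arveson's Radon-Nikodym theorem. The bounds 0 \<le> T \<le> 1 follow later from
  \<open>completely_positive_compress_iff\<close>.\<close>

lemma radon_nikodym:
  assumes cp: "completely_positive \<theta>" and le: "completely_positive (compress id_blinfun - \<theta>)"
  obtains T where "T \<in> commutant (range \<rho>)" "compress T = \<theta>"
proof -
  obtain T where T: "T \<in> bounded_ops"
    and T_eq: "\<And>xs ys. cinner (tensor_map xs) (T (tensor_map ys)) = kernel \<theta> xs ys"
    using kernel_operator[OF assms] by blast
  have elem: "cinner (\<rho> a (V h)) (T (\<rho> b (V k))) = cinner h (\<theta> (star a * b) k)" for a h b k
    using T_eq[of "[(a, h)]" "[(b, k)]"] by (simp add: tensor_map_def kernel_def)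
  have "T o\<^sub>L \<rho> c = \<rho> c o\<^sub>L T" for c
  proof (rule operator_eqI)
    fix a h b k
    have "cinner (\<rho> a (V h)) (T (\<rho> c (\<rho> b (V k)))) = cinner h (\<theta> (star a * (c * b)) k)"
      using elem[of a h "c * b" k] by (simp add: rho_mult)
    also have "\<dots> = cinner h (\<theta> (star (star c * a) * b) k)"
      by (simp add: star_mult star_star mult.assoc)
    also have "\<dots> = cinner (\<rho> (star c) (\<rho> a (V h))) (T (\<rho> b (V k)))"
      by (simp add: elem[symmetric] rho_mult)
    also have "\<dots> = cinner (\<rho> a (V h)) (\<rho> c (T (\<rho> b (V k))))"
      by (simp add: cinner_rho_star[symmetric] star_star)
    finally show "cinner (\<rho> a (V h)) ((T o\<^sub>L \<rho> c) (\<rho> b (V k)))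
        = cinner (\<rho> a (V h)) ((\<rho> c o\<^sub>L T) (\<rho> b (V k)))"
      by simp
  qed
  then have comm: "T \<in> commutant (range \<rho>)"
    using T by (auto simp: commutant_def)
  have star_1: "star 1 = (1 :: 'a)"
    by (metis mult_1 mult_1_right star_mult star_star)
  \<comment> \<open>Putting 1 in the left slot of the form recovers the map from it.\<close>
  have "compress T a = \<theta> a" for a
  proof (intro blinfun_eqI cinner_eqI)
    fix k h
    show "cinner h (compress T a k) = cinner h (\<theta> a k)"
      using elem[of 1 h a k] cinner_compress_star_mult[OF comm, of h 1 a k] by (simp add: star_1)
  qed
  with comm show thesis by (intro that) auto
qed

section \<open>Invariance and commutation with a unitary implementing a map of the algebra\<close>

lemma covariant_unitary_apply:
  assumes "unitary W" "W o\<^sub>L V = V" "\<And>a. W o\<^sub>L \<rho> a o\<^sub>L adj W = \<rho> (\<alpha> a)"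
  shows "W (V h) = V h" "\<rho> (\<alpha> a) (W x) = W (\<rho> a x)" "cinner (W x) (W y) = cinner x y"
proof -
  show "W (V h) = V h"
    using assms(2) by (metis blinfun_apply_blinfun_compose)
  show "\<rho> (\<alpha> a) (W x) = W (\<rho> a x)"
    by (simp add: assms(3)[symmetric] unitary_adj_apply[OF assms(1)])
  show "cinner (W x) (W y) = cinner x y"
    using assms(1) cinner_adj_left[of W "W x" y] by (simp add: unitary_def unitary_adj_apply)
qed

text \<open>Since \<open>W\<close> fixes the range of \<open>V\<close>, it can be inserted on both
  sides of the inner product, moved through \<open>T\<close> and \<open>\<rho>\<close>, and
  cancelled by unitarity.\<close>

lemma compress_invariant:
  assumes W: "unitary W" "W o\<^sub>L V = V" "\<And>a. W o\<^sub>L \<rho> a o\<^sub>L adj W = \<rho> (\<alpha> a)"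
    and comm: "\<And>x. blinfun_apply T (W x) = W (T x)"
  shows "compress T (\<alpha> a) = compress T a"
proof (intro blinfun_eqI cinner_eqI)
  note W' = covariant_unitary_apply[of W \<alpha>, OF W]
  fix h k
  have "cinner h (compress T (\<alpha> a) k) = cinner (W (V h)) (\<rho> (\<alpha> a) (T (W (V k))))"
    by (simp add: cinner_compress W')
  also have "\<dots> = cinner h (compress T a k)"
    \<comment> \<open>With \<open>W'(1)\<close> active the inserted \<open>W\<close> would be
      absorbed into \<open>V h\<close> before it can be cancelled.\<close>
    by (simp add: comm W' cinner_compress del: W'(1))
  finally show "cinner h (compress T (\<alpha> a) k) = cinner h (compress T a k)" .
qed

lemma commute_covariant_unitary:
  assumes W: "unitary W" "W o\<^sub>L V = V" "\<And>a. W o\<^sub>L \<rho> a o\<^sub>L adj W = \<rho> (\<alpha> a)"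
    and \<alpha>: "star_automorphism \<alpha>" and T: "T \<in> commutant (range \<rho>)"
    and inv: "\<And>a. compress T (\<alpha> a) = compress T a"
  shows "T o\<^sub>L W = W o\<^sub>L T"
proof (rule operator_eqI)
  note W' = covariant_unitary_apply[of W \<alpha>, OF W]
  have W_rho: "W (\<rho> a (V h)) = \<rho> (\<alpha> a) (V h)" for a h
    using W'(2)[of a "V h"] by (simp add: W'(1))
  fix a h b k
  \<comment> \<open>Surjectivity of \<alpha> puts both slots into its range, so that the product
    \<open>star a * \<alpha> b\<close> is an image under \<alpha> and invariance applies.\<close>
  obtain a' where a': "a = \<alpha> a'"
    using \<alpha> by (metis star_automorphism_def bij_pointE)
  have "cinner (\<rho> a (V h)) (T (W (\<rho> b (V k)))) = cinner h (compress T (star a * \<alpha> b) k)"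
    by (simp add: W_rho cinner_compress_star_mult[OF T])
  also have "star a * \<alpha> b = \<alpha> (star a' * b)"
    using \<alpha> by (simp add: a' star_automorphism_def)
  also have "cinner h (compress T (\<alpha> (star a' * b)) k) = cinner (\<rho> a' (V h)) (T (\<rho> b (V k)))"
    by (simp add: inv cinner_compress_star_mult[OF T])
  also have "\<dots> = cinner (\<rho> a (V h)) (W (T (\<rho> b (V k))))"
    by (simp add: a' W_rho[symmetric] W'(3))
  finally show "cinner (\<rho> a (V h)) ((T o\<^sub>L W) (\<rho> b (V k))) = cinner (\<rho> a (V h)) ((W o\<^sub>L T) (\<rho> b (V k)))"
    by simp
qed

end

section \<open>The order isomorphism onto the invariant maps below \<phi>\<close>

theorem lemma4p1:
  fixes G :: "('g, 'm) monoid_scheme"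
    and \<tau> :: "'g \<Rightarrow> 'a::unital_cstar_algebra \<Rightarrow> 'a"
    and \<phi> :: "'a \<Rightarrow> 'h::complex_hilbert_space \<Rightarrow>\<^sub>L 'h"
    and V :: "'h \<Rightarrow>\<^sub>L 'k::complex_hilbert_space"
    and \<rho> :: "'a \<Rightarrow> 'k \<Rightarrow>\<^sub>L 'k"
    and U :: "'g \<Rightarrow> 'k \<Rightarrow>\<^sub>L 'k"
  assumes "separable_space (euclidean :: 'a topology)"
    and "separable_space (euclidean :: 'h topology)"
    and "group G"
    and "\<tau> \<in> hom G Aut"
    and "\<phi> \<in> invariant_UCP G \<tau>"
    and "minimal_stinespring \<phi> V \<rho>"
    and "associated_unitary_rep G \<tau> V \<rho> U"
  shows "affine_order_iso
           {T \<in> commutant (range \<rho> \<union> U ` carrier G). op_le 0 T \<and> op_le T id_blinfun} op_le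
           (cp_interval \<phi> \<inter> invariant_CP G \<tau>) cp_le
           (\<lambda>T a. adj V o\<^sub>L \<rho> a o\<^sub>L T o\<^sub>L V)"
    (is "affine_order_iso ?C _ ?D _ _")
proof -
  interpret stinespring_dilation V \<rho>
    using assms(6) by unfold_locales (simp_all add: minimal_stinespring_def isometry_def)
  have \<phi>: "\<phi> = compress id_blinfun"
    using assms(6) by (auto simp: minimal_stinespring_def compress_def fun_eq_iff intro!: blinfun_eqI)
  have U: "unitary (U g)" "U g o\<^sub>L V = V" "\<And>a. U g o\<^sub>L \<rho> a o\<^sub>L adj (U g) = \<rho> (\<tau> g a)"
    and \<tau>: "star_automorphism (\<tau> g)" if "g \<in> carrier G" for g
    using assms(4,7) that
    by (auto simp: associated_unitary_rep_def hom_def unitary_group_def Aut_def Pi_iff)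
  have comm: "T \<in> commutant (range \<rho>)" if "T \<in> ?C" for T
    using that commutant_antimono[of "range \<rho>" "range \<rho> \<union> U ` carrier G"] by auto
  have iff: "op_le S T \<longleftrightarrow> cp_le (compress S) (compress T)"
    if "S \<in> commutant (range \<rho>)" "T \<in> commutant (range \<rho>)" for S T
    using completely_positive_compress_iff[OF commutant_diff[OF that(2,1)]]
    by (simp add: op_le_def cp_le_def compress_diff)
  \<comment> \<open>With this, both bounds of the interval are instances of \<open>iff\<close>: 0 is
    sent to 0 and the identity to \<phi>.\<close>
  have zero: "0 \<in> commutant (range \<rho>)" "compress 0 = 0"
    using commutant_diff[OF commutant_id commutant_id] compress_diff[of 0 0] by simp_all
  have interval: "compress T \<in> cp_interval \<phi> \<longleftrightarrow> op_le 0 T \<and> op_le T id_blinfun"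
    if "T \<in> commutant (range \<rho>)" for T
    using iff[OF zero(1) that] iff[OF that commutant_id]
    by (simp add: cp_interval_def cp_le_def zero(2) \<phi>)
  have "compress ` ?C = ?D"
  proof
    show "compress ` ?C \<subseteq> ?D"
    proof clarify
      fix T assume T: "T \<in> commutant (range \<rho> \<union> U ` carrier G)" "op_le 0 T" "op_le T id_blinfun"
      then have "compress T \<in> cp_interval \<phi>"
        using interval comm by blast
      moreover have "compress T (\<tau> g a) = compress T a" if "g \<in> carrier G" for g a
        using that by (intro compress_invariant[OF U] commutant_commute[OF T(1)]) auto
      ultimately show "compress T \<in> ?D"
        by (simp add: cp_interval_def invariant_CP_def)
    qed
    show "?D \<subseteq> compress ` ?C"
    proof
      fix \<theta> assume \<theta>: "\<theta> \<in> ?D"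
      then obtain T where T: "T \<in> commutant (range \<rho>)" "compress T = \<theta>"
        using radon_nikodym[of \<theta>] by (auto simp: cp_interval_def \<phi>)
      \<comment> \<open>Each group element is treated separately, with \<open>U g\<close> as the
        unitary implementing \<open>\<tau> g\<close>.\<close>
      have "T o\<^sub>L U g = U g o\<^sub>L T" if "g \<in> carrier G" for g
        using \<theta> that by (intro commute_covariant_unitary[OF U \<tau> T(1)]) (auto simp: T(2) invariant_CP_def)
      then have "T \<in> commutant (range \<rho> \<union> U ` carrier G)"
        using T(1) by (auto simp: commutant_def)
      then show "\<theta> \<in> compress ` ?C"
        using \<theta> T interval by auto
    qed
  qed
  then have "affine_order_iso ?C op_le ?D cp_le compress"
    by (intro affine_order_isoI ordered_convex_commutant_interval compress_convex_comb iff comm)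
  then show ?thesis
    by (simp add: compress_def[abs_def])
qed

end
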